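(* Let $d \ge 1$ and let $\mathcal{F_R}=\{R_1,\dots,R_m,f_1,\dots,f_n\}$ ($m,n>0$) be an R-IFS on $\mathbb{R}^d$. Then $\mathcal{F_R}$ has a compact semiattractor; that is, the set $$\bigcap_{x\in\mathbb{R}^d} Li\big(F^k(\{x\})\big)_{k\in\mathbb{N}}$$ is nonempty and compact, where $F(A)=\big[\bigcup_{i=1}^m R_i(A)\big]\cup\big[\bigcup_{j=1}^n f_j(A)\big]$ for $A\subset\mathbb{R}^d$.
   Context: $\mathbb{R}^d$ carries the Euclidean norm. A map $f$ on a metric space $(X,\rho)$ is a (Banach) contraction if there is $\alpha\in[0,1)$ with $\rho(f(x),f(y))\le\alpha\,\rho(x,y)$ for all $x,y$; it is isometric if $\rho(f(x),f(y))=\rho(x,y)$ for all $x,y$. An R-IFS on $\mathbb{R}^d$ is a function system $\{R_1,\dots,R_m,f_1,\dots,f_n\}$ with $m,n>0$, where each $R_i:\mathbb{R}^d\to\mathbb{R}^d$ is an isometric mapping with $R_i(0)=0$ and each $f_j:\mathbb{R}^d\to\mathbb{R}^d$ is a contraction. $F^k$ denotes the $k$-fold composition of the operator $F$. For a sequence $(S_k)$ of subsets of a metric space $X$, the lower Kuratowski limit is $Li(S_k)=\{y\in X: y=\lim_{k\to\infty}x_k \text{ for some sequence with } x_k\in S_k \text{ for all } k\in\mathbb{N}\}$. A nonempty closed set $A^*\subset X$ is a semiattractor of a finite system of continuous self-maps of $X$ with Hutchinson operator $F$ (where $F(A)$ is the union of the images of $A$ under the maps of the system) if $\bigcap_{x\in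 X}Li(F^k(\{x\}))=A^*$. *)

theory Defs
  imports "HOL-Analysis.Analysis"
begin

definition contraction :: "('a::metric_space \<Rightarrow> 'a) \<Rightarrow> bool" where
  "contraction f \<longleftrightarrow> (\<exists>\<alpha>. 0 \<le> \<alpha> \<and> \<alpha> < 1 \<and> (\<forall>x y. dist (f x) (f y) \<le> \<alpha> * dist x y))"

definition isometric :: "('a::metric_space \<Rightarrow> 'a) \<Rightarrow> bool" where
  "isometric f \<longleftrightarrow> (\<forall>x y. dist (f x) (f y) = dist x y)"

text \<open>An R-IFS is kept as the two indexed families it consists of, \<open>R 1, \<dots>, R m\<close> and
  \<open>f 1, \<dots>, f n\<close>; values of \<open>R\<close> and \<open>f\<close> at other indices are irrelevant.\<close>

definition R_IFS ::
  "nat \<Rightarrow> (nat \<Rightarrow> real ^ 'd \<Rightarrow> real ^ 'd) \<Rightarrow> nat \<Rightarrow> (nat \<Rightarrow> real ^ 'd \<Rightarrow> real ^ 'd) \<Rightarrow> bool" where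
  "R_IFS m R n f \<longleftrightarrow> m > 0 \<and> n > 0 \<and>
     (\<forall>i\<in>{1..m}. isometric (R i) \<and> R i 0 = 0) \<and>
     (\<forall>j\<in>{1..n}. contraction (f j))"

definition R_IFS_maps ::
  "nat \<Rightarrow> (nat \<Rightarrow> 'a \<Rightarrow> 'a) \<Rightarrow> nat \<Rightarrow> (nat \<Rightarrow> 'a \<Rightarrow> 'a) \<Rightarrow> ('a \<Rightarrow> 'a) set" where
  "R_IFS_maps m R n f = R ` {1..m} \<union> f ` {1..n}"

definition hutchinson :: "('a \<Rightarrow> 'a) set \<Rightarrow> 'a set \<Rightarrow> 'a set" where
  "hutchinson \<F> A = (\<Union>g\<in>\<F>. g ` A)"

definition lower_Kuratowski :: "(nat \<Rightarrow> 'a::metric_space set) \<Rightarrow> 'a set" where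
  "lower_Kuratowski S = {y. \<exists>x. (\<forall>k. x k \<in> S k) \<and> x \<longlonglongrightarrow> y}"

definition semiattractor :: "('a::metric_space \<Rightarrow> 'a) set \<Rightarrow> 'a set \<Rightarrow> bool" where
  "semiattractor \<F> A \<longleftrightarrow>
     finite \<F> \<and> (\<forall>g\<in>\<F>. continuous_on UNIV g) \<and>
     A \<noteq> {} \<and> closed A \<and>
     (\<Inter>x. lower_Kuratowski (\<lambda>k. (hutchinson \<F> ^^ k) {x})) = A"

end

theory Submission
  imports Defs
begin

text \<open>Iterating a single contraction \<open>f\<close> drives every starting point to the fixed point of \<open>f\<close>, so
  this point lies in every lower limit. Since isometries fixing \<open>0\<close> preserve every ball around
  \<open>0\<close> and contractions preserve every sufficiently large one, the orbit of \<open>0\<close> is bounded; lower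
  limits being closed, the intersection is compact.\<close>

lemma contraction_continuous_on:
  assumes "contraction f"
  shows "continuous_on S f"
proof -
  obtain \<alpha> where "0 \<le> \<alpha>" "\<forall>x y. dist (f x) (f y) \<le> \<alpha> * dist x y"
    using assms by (auto simp: contraction_def)
  then have "\<alpha>-lipschitz_on S f" by (auto simp: lipschitz_on_def)
  then show ?thesis by (rule lipschitz_on_continuous_on)
qed

lemma isometric_continuous_on:
  assumes "isometric f"
  shows "continuous_on S f"
proof -
  have "1-lipschitz_on S f" using assms by (auto simp: lipschitz_on_def isometric_def)
  then show ?thesis by (rule lipschitz_on_continuous_on)
qed

text \<open>Banach's theorem supplies the fixed point. Each application of \<open>f\<close> shrinks
  the distance to it by the factor \<open>\<alpha>\<close>, so a geometric bound gives convergence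
  from every start to the same limit.\<close>

lemma contraction_iterates_tendsto_fixpoint:
  fixes f :: "'a::complete_space \<Rightarrow> 'a"
  assumes "contraction f"
  obtains p where "f p = p" "\<And>x. (\<lambda>k. (f ^^ k) x) \<longlonglongrightarrow> p"
proof -
  obtain \<alpha> where \<alpha>: "0 \<le> \<alpha>" "\<alpha> < 1" "\<And>x y. dist (f x) (f y) \<le> \<alpha> * dist x y"
    using assms by (auto simp: contraction_def)
  have "\<exists>!x. f x = x" by (rule banach_fix_type[OF \<alpha>(1,2)]) (simp add: \<alpha>(3))
  then obtain p where p: "f p = p" by blast
  have "(\<lambda>k. (f ^^ k) x) \<longlonglongrightarrow> p" for x
  proof -
    have bound: "dist ((f ^^ k) x) p \<le> \<alpha> ^ k * dist x p" for k
    proof (induction k)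
      case (Suc k)
      have "dist (f ((f ^^ k) x)) (f p) \<le> \<alpha> * dist ((f ^^ k) x) p" by (rule \<alpha>)
      also have "\<dots> \<le> \<alpha> * (\<alpha> ^ k * dist x p)" using Suc \<alpha>(1) by (rule mult_left_mono)
      finally show ?case by (simp add: p mult.assoc)
    qed simp
    have "(\<lambda>k. \<alpha> ^ k * dist x p) \<longlonglongrightarrow> 0"
      using \<alpha>(1,2) by (intro tendsto_mult_left_zero LIMSEQ_realpow_zero)
    then have "(\<lambda>k. dist ((f ^^ k) x) p) \<longlonglongrightarrow> 0"
      by (rule tendsto_sandwich[OF _ _ tendsto_const, rotated 2]) (simp_all add: bound)
    then show ?thesis by (rule tendsto_dist_iff[THEN iffD2])
  qed
  with p show thesis by (rule that)
qed

text \<open>On \<open>cball 0 r\<close> the norm of \<open>f x\<close> is at most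
  \<open>norm (f 0) + \<alpha> * r\<close>, which is at most \<open>r\<close> as soon as
  \<open>r\<close> reaches \<open>norm (f 0) / (1 - \<alpha>)\<close>. Stating this eventually in
  \<open>r\<close> lets finitely many contractions share one radius.\<close>

lemma contraction_maps_large_cballs:
  fixes f :: "'a::real_normed_vector \<Rightarrow> 'a"
  assumes "contraction f"
  shows "\<forall>\<^sub>F r in at_top. f ` cball 0 r \<subseteq> cball 0 r"
proof -
  obtain \<alpha> where \<alpha>: "0 \<le> \<alpha>" "\<alpha> < 1" "\<And>x y. dist (f x) (f y) \<le> \<alpha> * dist x y"
    using assms by (auto simp: contraction_def)
  show ?thesis
    using eventually_ge_at_top[of "norm (f 0) / (1 - \<alpha>)"]
  proof eventually_elim
    case (elim r)
    then have r: "norm (f 0) \<le> (1 - \<alpha>) * r" using \<alpha>(2) by (simp add: field_simps)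
    have "norm (f x) \<le> r" if "norm x \<le> r" for x
    proof -
      have "norm (f x) \<le> norm (f 0) + dist (f x) (f 0)"
        using norm_triangle_ineq[of "f 0" "f x - f 0"] by (simp add: dist_norm)
      also have "\<dots> \<le> (1 - \<alpha>) * r + \<alpha> * r"
        using r \<alpha>(3)[of x 0] mult_left_mono[OF that \<alpha>(1)] by simp
      finally show ?thesis by (simp add: algebra_simps)
    qed
    then show ?case by auto
  qed
qed

lemma isometric_norm:
  fixes f :: "'a::real_normed_vector \<Rightarrow> 'a"
  assumes "isometric f" "f 0 = 0"
  shows "norm (f x) = norm x"
  using assms unfolding isometric_def by (metis dist_0_norm)

text \<open>This trades the choice of a sequence for a numerical limit. The sets must be nonempty
  because \<open>infdist\<close> to the empty set is 0 by convention.\<close>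

lemma lower_Kuratowski_iff_infdist:
  assumes "\<And>k. S k \<noteq> {}"
  shows "y \<in> lower_Kuratowski S \<longleftrightarrow> (\<lambda>k. infdist y (S k)) \<longlonglongrightarrow> 0"
proof
  assume "y \<in> lower_Kuratowski S"
  then obtain x where x: "\<And>k. x k \<in> S k" "x \<longlonglongrightarrow> y" by (auto simp: lower_Kuratowski_def)
  show "(\<lambda>k. infdist y (S k)) \<longlonglongrightarrow> 0"
  proof (rule tendsto_sandwich[OF _ _ tendsto_const])
    show "(\<lambda>k. dist y (x k)) \<longlonglongrightarrow> 0"
      using tendsto_dist[OF tendsto_const x(2)] by (metis dist_self)
  qed (use x(1) in \<open>simp_all add: infdist_nonneg infdist_le\<close>)
next
  assume lim: "(\<lambda>k. infdist y (S k)) \<longlonglongrightarrow> 0"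
  \<comment> \<open>The infimum need not be attained, so a slack tending to 0 is allowed when
    choosing a point of \<open>S k\<close>.\<close>
  have "\<exists>x\<in>S k. dist y x < infdist y (S k) + inverse (real (Suc k))" for k
    using assms[of k] cInf_lessD[of "dist y ` S k" "infdist y (S k) + inverse (real (Suc k))"]
    by (auto simp: infdist_def)
  then obtain x where x: "\<And>k. x k \<in> S k"
    "\<And>k. dist y (x k) < infdist y (S k) + inverse (real (Suc k))" by metis
  have "(\<lambda>k. dist (x k) y) \<longlonglongrightarrow> 0"
  proof (rule tendsto_sandwich[OF _ _ tendsto_const])
    show "(\<lambda>k. infdist y (S k) + inverse (real (Suc k))) \<longlonglongrightarrow> 0"
      using tendsto_add[OF lim LIMSEQ_inverse_real_of_nat] by simp
    show "\<forall>\<^sub>F k in sequentially. dist (x k) y \<le> infdist y (S k) + inverse (real (Suc k))"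
      using x(2) by (simp add: dist_commute less_imp_le)
  qed simp
  then have "x \<longlonglongrightarrow> y" by (rule tendsto_dist_iff[THEN iffD2])
  with x(1) show "y \<in> lower_Kuratowski S" by (auto simp: lower_Kuratowski_def)
qed

text \<open>The distance to a fixed set is 1-Lipschitz in the point, so a limit of points whose
  distances to \<open>S k\<close> vanish inherits this property.\<close>

lemma closed_lower_Kuratowski: "closed (lower_Kuratowski S)"
proof (cases "\<forall>k. S k \<noteq> {}")
  case True
  show ?thesis unfolding closed_sequential_limits
  proof (intro allI impI, elim conjE)
    fix y l assume y: "\<forall>n. y n \<in> lower_Kuratowski S" "y \<longlonglongrightarrow> l"
    have "(\<lambda>k. infdist l (S k)) \<longlonglongrightarrow> 0"
    proof (rule order_tendstoI)
      fix e :: real assume "0 < e"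
      \<comment> \<open>One index \<open>n\<close> is fixed first: half of \<open>e\<close> pays for
        moving from \<open>l\<close> to \<open>y n\<close>, the other half for the distance from
        \<open>y n\<close> to \<open>S k\<close> with \<open>k\<close> large.\<close>
      then obtain n where n: "dist (y n) l < e / 2"
        using metric_LIMSEQ_D[OF y(2), of "e / 2"] by auto
      have "(\<lambda>k. infdist (y n) (S k)) \<longlonglongrightarrow> 0"
        using y(1) True by (simp add: lower_Kuratowski_iff_infdist)
      then have "\<forall>\<^sub>F k in sequentially. infdist (y n) (S k) < e / 2"
        using \<open>0 < e\<close> by (intro order_tendstoD(2)) auto
      then show "\<forall>\<^sub>F k in sequentially. infdist l (S k) < e"
      proof eventually_elim
        case (elim k)
        then show ?case using infdist_triangle[of l "S k" "y n"] n by (simp add: dist_commute)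
      qed
    qed (auto intro: always_eventually less_le_trans infdist_nonneg)
    then show "l \<in> lower_Kuratowski S" using True by (simp add: lower_Kuratowski_iff_infdist)
  qed
next
  case False
  \<comment> \<open>A single empty \<open>S k\<close> already rules out any sequence with a term in
    every set.\<close>
  then have "lower_Kuratowski S = {}" by (auto simp: lower_Kuratowski_def)
  then show ?thesis by simp
qed

lemma lower_Kuratowski_subset_closed:
  assumes "closed C" "\<And>k. S k \<subseteq> C"
  shows "lower_Kuratowski S \<subseteq> C"
proof
  fix y assume "y \<in> lower_Kuratowski S"
  then obtain x where x: "\<And>k. x k \<in> S k" "x \<longlonglongrightarrow> y" by (auto simp: lower_Kuratowski_def)
  show "y \<in> C" by (rule closed_sequentially[OF assms(1) _ x(2)]) (use x(1) assms(2) in blast)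
qed

text \<open>Applying the same map at every step is one of the choices the operator offers; this
  yields the sequence that membership in a lower limit demands.\<close>

lemma funpow_in_hutchinson_funpow:
  assumes "g \<in> \<F>"
  shows "(g ^^ k) x \<in> (hutchinson \<F> ^^ k) {x}"
  by (induction k) (use assms in \<open>auto simp: hutchinson_def\<close>)

lemma hutchinson_funpow_subset:
  assumes "\<And>g. g \<in> \<F> \<Longrightarrow> g ` C \<subseteq> C" "A \<subseteq> C"
  shows "(hutchinson \<F> ^^ k) A \<subseteq> C"
proof (induction k)
  case (Suc k)
  then show ?case using assms(1) by (fastforce simp: hutchinson_def)
qed (use assms in simp)

lemma semiattractor_R_IFS:
  fixes R f :: "nat \<Rightarrow> real ^ 'd \<Rightarrow> real ^ 'd" and m n :: nat
  assumes "R_IFS m R n f"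
  defines "\<F> \<equiv> R_IFS_maps m R n f"
  defines "A \<equiv> (\<Inter>x. lower_Kuratowski (\<lambda>k. (hutchinson \<F> ^^ k) {x}))"
  shows "semiattractor \<F> A" "compact A"
proof -
  have R: "isometric (R i)" "R i 0 = 0" if "i \<in> {1..m}" for i
    using assms(1) that by (auto simp: R_IFS_def)
  have f: "contraction (f j)" if "j \<in> {1..n}" for j
    using assms(1) that by (auto simp: R_IFS_def)
  \<comment> \<open>Here \<open>n > 0\<close> provides a contraction, whose fixed point will witness
    that \<open>A\<close> is nonempty.\<close>
  have 1: "1 \<in> {1..n}" using assms(1) by (simp add: R_IFS_def)
  have "closed A" unfolding A_def by (intro closed_INT ballI closed_lower_Kuratowski)

  obtain p where p: "\<And>x. (\<lambda>k. (f 1 ^^ k) x) \<longlonglongrightarrow> p"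
    using contraction_iterates_tendsto_fixpoint[OF f[OF 1]] by metis
  have "f 1 \<in> \<F>" using 1 by (auto simp: \<F>_def R_IFS_maps_def)
  \<comment> \<open>The limit \<open>p\<close> is the same for every starting point
    \<open>x\<close>, hence it lies in every member of the intersection.\<close>
  then have "p \<in> A"
    using p by (force simp: A_def lower_Kuratowski_def intro: funpow_in_hutchinson_funpow)

  \<comment> \<open>Finiteness of the index set allows the quantifier over \<open>j\<close> to move
    inside the eventual statement.\<close>
  have "\<forall>\<^sub>F r in at_top. \<forall>j\<in>{1..n}. f j ` cball 0 r \<subseteq> cball 0 r"
    using f by (simp add: eventually_ball_finite_distrib contraction_maps_large_cballs)
  \<comment> \<open>The bound \<open>0 \<le> r\<close> puts the starting point 0 into the
    ball.\<close>
  then have "\<forall>\<^sub>F r in at_top. 0 \<le> r \<and> (\<forall>j\<in>{1..n}. f j ` cball 0 r \<subseteq> cball 0 r)"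
    by (intro eventually_conj eventually_ge_at_top)
  then obtain r where r: "0 \<le> r" "\<And>j. j \<in> {1..n} \<Longrightarrow> f j ` cball 0 r \<subseteq> cball 0 r"
    by (auto dest!: eventually_happens)
  have "g ` cball 0 r \<subseteq> cball 0 r" if "g \<in> \<F>" for g
    using that unfolding \<F>_def R_IFS_maps_def
  proof
    assume "g \<in> R ` {1..m}"
    then show ?thesis using R by (auto simp: isometric_norm)
  next
    assume "g \<in> f ` {1..n}"
    then show ?thesis using r(2) by (elim imageE) simp
  qed
  then have "lower_Kuratowski (\<lambda>k. (hutchinson \<F> ^^ k) {0}) \<subseteq> cball 0 r"
    using r(1) by (intro lower_Kuratowski_subset_closed hutchinson_funpow_subset) auto
  \<comment> \<open>It is enough to bound the member at \<open>x = 0\<close>, since it contains the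
    whole intersection; compactness is then Heine-Borel.\<close>
  then have "A \<subseteq> cball 0 r" by (auto simp: A_def)
  then show "compact A"
    using \<open>closed A\<close> bounded_cball bounded_subset by (auto simp: compact_eq_bounded_closed)

  have "continuous_on UNIV g" if "g \<in> \<F>" for g
    using that R f
    by (auto simp: \<F>_def R_IFS_maps_def intro: isometric_continuous_on contraction_continuous_on)
  then show "semiattractor \<F> A"
    using \<open>closed A\<close> \<open>p \<in> A\<close> unfolding semiattractor_def
    by (auto simp: A_def \<F>_def R_IFS_maps_def)
qed

theorem mainTheorem3:
  fixes R f :: "nat \<Rightarrow> real ^ 'd \<Rightarrow> real ^ 'd" and m n :: nat
  assumes "R_IFS m R n f"
  shows "(\<exists>A. semiattractor (R_IFS_maps m R n f) A \<and> compact A) \<and>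
    (let F = (\<lambda>A. (\<Union>i\<in>{1..m}. R i ` A) \<union> (\<Union>j\<in>{1..n}. f j ` A));
         S = (\<Inter>x. lower_Kuratowski (\<lambda>k. (F ^^ k) {x}))
     in S \<noteq> {} \<and> compact S)"
proof -
  \<comment> \<open>The explicit union over indices equals the union over the set of maps, even if
    some maps coincide, so both conclusions concern the same intersection.\<close>
  have F: "(\<lambda>A. (\<Union>i\<in>{1..m}. R i ` A) \<union> (\<Union>j\<in>{1..n}. f j ` A)) = hutchinson (R_IFS_maps m R n f)"
    by (auto simp: fun_eq_iff hutchinson_def R_IFS_maps_def)
  show ?thesis
    using semiattractor_R_IFS[OF assms] unfolding F Let_def by (auto simp: semiattractor_def)
qed

end
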